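(* Let $n\geq 0$ be an integer. (1) Let $(I,+_I,\preceq_I,J,+_J,\preceq_J,K,+_K,\preceq_K,\ast)\in\mathcal{C}$ with $I=J$ and $\preceq_I=\preceq_J$, and suppose $K$ is a partially ordered real vector space. Let $x,y,z\in I$ with $x\succeq_I y\succeq_I z$ and let $a,b,c\in\mathbb{R}$ with $a,c\geq 0$ and $a+c\geq |b|$. Then $$a\,(x-_I y)\ast(x-_J z) + b\,(y-_I x)\ast(y-_J z) + c\,(z-_I x)\ast(z-_J y)\succeq_K 0.$$ (2) Let $(I,+,\preceq_I,\ast)\in\mathcal{C}_2$, let $x,y,z\in I$ with $x\succeq_I y\succeq_I z$, and let $a,b,c\in I$ be such that $a\succeq_I 0$, $c\succeq_I 0$, and $a+c$ is an upper bound of $\{b,-b\}$. Then $$a\ast(x-y)^n\ast(x-z)^n + b\ast(y-x)^n\ast(y-z)^n + c\ast(z-x)^n\ast(z-y)^n\succeq_I 0.$$ (3) Let $(I,+,\preceq_I,\ast)\in\mathcal{C}_2$ where $I$ is a partially ordered real vector space, let $x,y,z\in I$ with $x\succeq_I y\succeq_I z$, let $a,b,c\in I$ be such that $a\succeq_I 0$, $c\succeq_I 0$, and $a+c$ is an upper bound of $\{b,-b\}$, and let $p:I\to I$ be in class $\mathcal{G}$. Then $$a\ast p(x-y)\ast p(x-z) + b\ast p(y-x)\ast p(y-z) + c\ast p(z-x)\ast p(z-y)\succeq_I 0.$$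
   Context: A partially ordered group $(G,+,\preceq)$ is a group $(G,+)$ with a partial order $\preceq$ such that $z+x\preceq z+y\Leftrightarrow x+z\preceq y+z\Leftrightarrow x\preceq y$ for all $x,y,z\in G$. $(G,+,\preceq)$ is a partially ordered real vector space if $(G,+,\preceq)$ is a partially ordered group, $G$ is a real vector space, and $x\preceq y$ implies $\lambda x\preceq\lambda y$ for all real $\lambda\geq 0$. $\mathcal{C}$ is the set of tuples $(I,+_I,\preceq_I,J,+_J,\preceq_J,K,+_K,\preceq_K,\ast)$ such that: (i) $(I,+_I,\preceq_I)$, $(J,+_J,\preceq_J)$, $(K,+_K,\preceq_K)$ are partially ordered Abelian groups; (ii) $\ast:I\times J\to K$ is distributive: $(x+_I y)\ast z = x\ast z+_K y\ast z$ and $x\ast(y+_J z)=x\ast y+_K x\ast z$; (iii) $\ast$ is nonnegativity-preserving: $x\succeq_I 0$ and $y\succeq_J 0$ imply $x\ast y\succeq_K 0$. Here $-_I$, $-_J$ denote subtraction in $(I,+_I)$, $(J,+_J)$. $\mathcal{C}_2$ is the set of tuples $(I,+,\preceq_I,\ast)$ such that $(I,+,\preceq_I,I,+,\preceq_I,I,+,\preceq_I,\ast)\in\mathcal{C}$. For $x\in I$, $x^n$ denotes the $n$-fold product $x\ast x\ast\cdots\ast x$ (for $n=0$, the identity of $\ast$ when it exists). The operation $\ast$ need not be associative or commutative; if it is not associative, the products in the three terms of each inequality are understood to be bracketed in the same fixed way. In a partially ordered set $(I,\preceq_I)$, $u$ is an upper bound of $S\subset I$ if $u\succeq_I s$ for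 all $s\in S$. A function $p:I\to I$ is in class $\mathcal{G}$ if $p(0)\succeq_I 0$; $x\succeq_I y\succeq_I 0$ implies $p(x)\succeq_I p(y)$; and either $p(x)=p(-x)$ for all $x\in I$ or $p(x)=-p(-x)$ for all $x\in I$. *)

theory Defs
  imports "HOL-Algebra.Module" "HOL-Algebra.Algebraic_Closure_Type"
begin

abbreviation rel_le :: "'a \<Rightarrow> 'a rel \<Rightarrow> 'a \<Rightarrow> bool"  ("(_/ \<preceq>\<^bsub>_\<^esub> _)" [51, 0, 51] 50)
  where "x \<preceq>\<^bsub>r\<^esub> y \<equiv> (x, y) \<in> r"

text \<open>
  An abelian group is the additive part of a ring record, as in HOL-Algebra; the multiplicative
  fields \<open>mult\<close> and \<open>one\<close> of the record are unconstrained and play no role anywhere below.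
  The order is a relation on the carrier.
\<close>

definition po_abelian_group :: "('a, 'm) ring_scheme \<Rightarrow> 'a rel \<Rightarrow> bool" where
  "po_abelian_group G leG \<longleftrightarrow>
     abelian_group G \<and> partial_order_on (carrier G) leG \<and>
     (\<forall>x\<in>carrier G. \<forall>y\<in>carrier G. \<forall>z\<in>carrier G.
        (z \<oplus>\<^bsub>G\<^esub> x \<preceq>\<^bsub>leG\<^esub> z \<oplus>\<^bsub>G\<^esub> y \<longleftrightarrow> x \<oplus>\<^bsub>G\<^esub> z \<preceq>\<^bsub>leG\<^esub> y \<oplus>\<^bsub>G\<^esub> z) \<and>
        (x \<oplus>\<^bsub>G\<^esub> z \<preceq>\<^bsub>leG\<^esub> y \<oplus>\<^bsub>G\<^esub> z \<longleftrightarrow> x \<preceq>\<^bsub>leG\<^esub> y))"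

text \<open>
  A real vector space is a module over the field of real numbers,
  \<open>ring_of_type_algebra :: real ring\<close>.
\<close>

definition po_real_vector_space :: "(real, 'a, 'm) module_scheme \<Rightarrow> 'a rel \<Rightarrow> bool" where
  "po_real_vector_space V leV \<longleftrightarrow>
     po_abelian_group V leV \<and> module (ring_of_type_algebra :: real ring) V \<and>
     (\<forall>x\<in>carrier V. \<forall>y\<in>carrier V. \<forall>r\<ge>0. x \<preceq>\<^bsub>leV\<^esub> y \<longrightarrow> r \<odot>\<^bsub>V\<^esub> x \<preceq>\<^bsub>leV\<^esub> r \<odot>\<^bsub>V\<^esub> y)"

definition class_C ::
  "('i, 'l) ring_scheme \<Rightarrow> 'i rel \<Rightarrow> ('j, 'm) ring_scheme \<Rightarrow> 'j rel \<Rightarrow>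
   ('k, 'n) ring_scheme \<Rightarrow> 'k rel \<Rightarrow> ('i \<Rightarrow> 'j \<Rightarrow> 'k) \<Rightarrow> bool" where
  "class_C I leI J leJ K leK ast \<longleftrightarrow>
     po_abelian_group I leI \<and> po_abelian_group J leJ \<and> po_abelian_group K leK \<and>
     (\<forall>x\<in>carrier I. \<forall>y\<in>carrier J. ast x y \<in> carrier K) \<and>
     (\<forall>x\<in>carrier I. \<forall>y\<in>carrier I. \<forall>z\<in>carrier J.
        ast (x \<oplus>\<^bsub>I\<^esub> y) z = ast x z \<oplus>\<^bsub>K\<^esub> ast y z) \<and>
     (\<forall>x\<in>carrier I. \<forall>y\<in>carrier J. \<forall>z\<in>carrier J.
        ast x (y \<oplus>\<^bsub>J\<^esub> z) = ast x y \<oplus>\<^bsub>K\<^esub> ast x z) \<and>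
     (\<forall>x\<in>carrier I. \<forall>y\<in>carrier J.
        \<zero>\<^bsub>I\<^esub> \<preceq>\<^bsub>leI\<^esub> x \<longrightarrow> \<zero>\<^bsub>J\<^esub> \<preceq>\<^bsub>leJ\<^esub> y \<longrightarrow> \<zero>\<^bsub>K\<^esub> \<preceq>\<^bsub>leK\<^esub> ast x y)"

definition class_C2 :: "('i, 'l) ring_scheme \<Rightarrow> 'i rel \<Rightarrow> ('i \<Rightarrow> 'i \<Rightarrow> 'i) \<Rightarrow> bool" where
  "class_C2 I leI ast \<longleftrightarrow> class_C I leI I leI I leI ast"

definition class_G :: "('i, 'l) ring_scheme \<Rightarrow> 'i rel \<Rightarrow> ('i \<Rightarrow> 'i) \<Rightarrow> bool" where
  "class_G I leI p \<longleftrightarrow>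
     p \<in> carrier I \<rightarrow> carrier I \<and>
     \<zero>\<^bsub>I\<^esub> \<preceq>\<^bsub>leI\<^esub> p \<zero>\<^bsub>I\<^esub> \<and>
     (\<forall>x\<in>carrier I. \<forall>y\<in>carrier I. \<zero>\<^bsub>I\<^esub> \<preceq>\<^bsub>leI\<^esub> y \<longrightarrow> y \<preceq>\<^bsub>leI\<^esub> x \<longrightarrow> p y \<preceq>\<^bsub>leI\<^esub> p x) \<and>
     ((\<forall>x\<in>carrier I. p x = p (\<ominus>\<^bsub>I\<^esub> x)) \<or> (\<forall>x\<in>carrier I. p x = \<ominus>\<^bsub>I\<^esub> p (\<ominus>\<^bsub>I\<^esub> x)))"

definition is_identity :: "'i set \<Rightarrow> ('i \<Rightarrow> 'i \<Rightarrow> 'i) \<Rightarrow> 'i \<Rightarrow> bool" where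
  "is_identity A ast e \<longleftrightarrow> e \<in> A \<and> (\<forall>x\<in>A. ast e x = x \<and> ast x e = x)"

text \<open>
  Since the operation need not be associative, a product of several factors depends on how it is
  bracketed. A bracketing is a binary tree; \<open>bprod ast t xs\<close> is the product, in order, of the
  factors \<open>xs\<close> bracketed according to \<open>t\<close>, and is meaningful when
  \<open>length xs = num_factors t\<close>.
\<close>

datatype bracketing = Factor | Bracket bracketing bracketing

fun num_factors :: "bracketing \<Rightarrow> nat" where
  "num_factors Factor = 1"
| "num_factors (Bracket s t) = num_factors s + num_factors t"

fun bprod :: "('i \<Rightarrow> 'i \<Rightarrow> 'i) \<Rightarrow> bracketing \<Rightarrow> 'i list \<Rightarrow> 'i" where
  "bprod ast Factor xs = hd xs"
| "bprod ast (Bracket s t) xs =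
     ast (bprod ast s (take (num_factors s) xs)) (bprod ast t (drop (num_factors s) xs))"

text \<open>
  The word of factors that \<open>x\<^sup>n\<close> contributes to a product: \<open>n\<close> copies of \<open>x\<close>, or the
  identity \<open>e\<close> of the operation if \<open>n = 0\<close>.
\<close>

definition power_word :: "'i \<Rightarrow> 'i \<Rightarrow> nat \<Rightarrow> 'i list" where
  "power_word e x n = (if n = 0 then [e] else replicate n x)"

text \<open>
  The bracketing that keeps the two powers together as units gives the expected products.
\<close>

lemma bprod_powers:
  assumes "length (power_word e u n) = num_factors s" "length (power_word e v n) = num_factors t"
  shows "bprod ast (Bracket (Bracket Factor s) t) (a # power_word e u n @ power_word e v n) =
           ast (ast a (bprod ast s (power_word e u n))) (bprod ast t (power_word e v n))"
  using assms by simp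

end

theory Submission
  imports Defs
begin

text \<open>
  Put \<open>u = x - y\<close>, \<open>v = y - z\<close> and \<open>w = x - z = u + v\<close>, so that \<open>u\<close>, \<open>v\<close> are nonnegative
  and bounded by \<open>w\<close>. A bracketed product is additive in each factor and monotone in nonnegative
  factors, so replacing \<open>w\<close> by \<open>v\<close> in the first summand and by \<open>u\<close> in the third only decreases
  the sum. All three summands then have the same factors apart from the leading coefficient,
  and up to a sign of the second one; since the two minus signs of the third summand
  cancel, the sum becomes the product with leading coefficient \<open>a + c + b\<close> or \<open>a + c - b\<close>,
  which is nonnegative.
\<close>

section \<open>Partially ordered abelian groups\<close>

locale po_group = abelian_group G for G :: "('a, 'b) ring_scheme" (structure) and leG +
  assumes po_abelian_group: "po_abelian_group G leG"
begin

lemma le_refl: "x \<in> carrier G \<Longrightarrow> x \<preceq>\<^bsub>leG\<^esub> x"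
  using po_abelian_group
  unfolding po_abelian_group_def partial_order_on_def preorder_on_def refl_on_def by blast

lemma le_trans: "x \<preceq>\<^bsub>leG\<^esub> y \<Longrightarrow> y \<preceq>\<^bsub>leG\<^esub> z \<Longrightarrow> x \<preceq>\<^bsub>leG\<^esub> z"
  using po_abelian_group
  unfolding po_abelian_group_def partial_order_on_def preorder_on_def trans_def by blast

lemma add_right_le_iff:
  assumes "x \<in> carrier G" "y \<in> carrier G" "z \<in> carrier G"
  shows "x \<oplus> z \<preceq>\<^bsub>leG\<^esub> y \<oplus> z \<longleftrightarrow> x \<preceq>\<^bsub>leG\<^esub> y"
  using po_abelian_group assms unfolding po_abelian_group_def by blast

lemma add_mono:
  assumes "x \<in> carrier G" "y \<in> carrier G" "u \<in> carrier G" "v \<in> carrier G"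
    and "x \<preceq>\<^bsub>leG\<^esub> y" "u \<preceq>\<^bsub>leG\<^esub> v"
  shows "x \<oplus> u \<preceq>\<^bsub>leG\<^esub> y \<oplus> v"
proof -
  have "x \<oplus> u \<preceq>\<^bsub>leG\<^esub> y \<oplus> u" using assms add_right_le_iff by blast
  moreover have "u \<oplus> y \<preceq>\<^bsub>leG\<^esub> v \<oplus> y" using assms add_right_le_iff by blast
  ultimately show ?thesis using assms le_trans by (metis a_comm)
qed

lemma add_nonneg:
  assumes "x \<in> carrier G" "y \<in> carrier G" "\<zero> \<preceq>\<^bsub>leG\<^esub> x" "\<zero> \<preceq>\<^bsub>leG\<^esub> y"
  shows "\<zero> \<preceq>\<^bsub>leG\<^esub> x \<oplus> y"
  using add_mono[of \<zero> x \<zero> y] assms by simp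

text \<open>Translation by \<open>\<ominus> x\<close> turns the left side into zero. Every order
  hypothesis on \<open>x\<close>, \<open>y\<close>, \<open>z\<close> enters the inequalities through
  this equivalence.\<close>

lemma le_iff_diff_nonneg:
  assumes "x \<in> carrier G" "y \<in> carrier G"
  shows "x \<preceq>\<^bsub>leG\<^esub> y \<longleftrightarrow> \<zero> \<preceq>\<^bsub>leG\<^esub> y \<ominus> x"
  using add_right_le_iff[of x y "\<ominus> x"] assms by (simp add: minus_eq r_neg)

lemma minus_diff_eq:
  assumes "x \<in> carrier G" "y \<in> carrier G"
  shows "\<ominus> (x \<ominus> y) = y \<ominus> x"
  using assms by (simp add: minus_eq minus_add a_comm)

lemma diff_eq_add_diffs:
  assumes "x \<in> carrier G" "y \<in> carrier G" "z \<in> carrier G"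
  shows "x \<ominus> z = (x \<ominus> y) \<oplus> (y \<ominus> z)"
  using assms by (simp add: minus_eq a_assoc r_neg2 r_neg1)

lemma le_add_nonneg:
  assumes "x \<in> carrier G" "y \<in> carrier G" "\<zero> \<preceq>\<^bsub>leG\<^esub> y"
  shows "x \<preceq>\<^bsub>leG\<^esub> x \<oplus> y" "x \<preceq>\<^bsub>leG\<^esub> y \<oplus> x"
  using add_mono[of x x \<zero> y] assms by (simp_all add: le_refl a_comm)

text \<open>An absolute value of \<open>b\<close> need not exist in \<open>G\<close>; bounding both
  \<open>b\<close> and \<open>\<ominus> b\<close> takes its place. The flag \<open>s\<close> covers
  both signs that \<open>b\<close> can acquire, and \<open>b\<close> stands in the middle to match
  the order of the three summands.\<close>

lemma coefficient_nonneg: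
  assumes "a \<in> carrier G" "b \<in> carrier G" "c \<in> carrier G"
    and ub: "a \<oplus> c \<in> Above leG {b, \<ominus> b}"
  shows "\<zero> \<preceq>\<^bsub>leG\<^esub> a \<oplus> (if s then \<ominus> b else b) \<oplus> c"
proof -
  have "b \<preceq>\<^bsub>leG\<^esub> a \<oplus> c" "\<ominus> b \<preceq>\<^bsub>leG\<^esub> a \<oplus> c"
    using ub unfolding Above_def by auto
  then have "\<zero> \<preceq>\<^bsub>leG\<^esub> (a \<oplus> c) \<ominus> b" "\<zero> \<preceq>\<^bsub>leG\<^esub> (a \<oplus> c) \<ominus> (\<ominus> b)"
    using assms by (simp_all only: le_iff_diff_nonneg a_closed a_inv_closed)
  moreover have "a \<oplus> \<ominus> b \<oplus> c = (a \<oplus> c) \<ominus> b" "a \<oplus> b \<oplus> c = (a \<oplus> c) \<ominus> (\<ominus> b)"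
    using assms by (simp_all add: minus_eq a_ac)
  ultimately show ?thesis by simp
qed

end

lemma po_groupI:
  assumes "po_abelian_group G leG"
  shows "po_group G leG"
  using assms by (simp add: po_group_def po_group_axioms_def po_abelian_group_def)

section \<open>Distributive operations that preserve nonnegativity\<close>

locale po_bilinear = I: po_group I leI + J: po_group J leJ + K: po_group K leK
  for I :: "('i, 'l) ring_scheme" and leI and J :: "('j, 'm) ring_scheme" and leJ
    and K :: "('k, 'n) ring_scheme" and leK +
  fixes ast :: "'i \<Rightarrow> 'j \<Rightarrow> 'k"
  assumes class_C: "class_C I leI J leJ K leK ast"
begin

lemma ast_closed: "x \<in> carrier I \<Longrightarrow> y \<in> carrier J \<Longrightarrow> ast x y \<in> carrier K"
  using class_C unfolding class_C_def by blast

lemma ast_add_left: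
  "x \<in> carrier I \<Longrightarrow> y \<in> carrier I \<Longrightarrow> z \<in> carrier J \<Longrightarrow>
    ast (x \<oplus>\<^bsub>I\<^esub> y) z = ast x z \<oplus>\<^bsub>K\<^esub> ast y z"
  using class_C unfolding class_C_def by blast

lemma ast_add_right:
  "x \<in> carrier I \<Longrightarrow> y \<in> carrier J \<Longrightarrow> z \<in> carrier J \<Longrightarrow>
    ast x (y \<oplus>\<^bsub>J\<^esub> z) = ast x y \<oplus>\<^bsub>K\<^esub> ast x z"
  using class_C unfolding class_C_def by blast

lemma ast_nonneg:
  "x \<in> carrier I \<Longrightarrow> y \<in> carrier J \<Longrightarrow> \<zero>\<^bsub>I\<^esub> \<preceq>\<^bsub>leI\<^esub> x \<Longrightarrow> \<zero>\<^bsub>J\<^esub> \<preceq>\<^bsub>leJ\<^esub> y \<Longrightarrow> \<zero>\<^bsub>K\<^esub> \<preceq>\<^bsub>leK\<^esub> ast x y"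
  using class_C unfolding class_C_def by blast

lemma ast_minus_left:
  assumes "x \<in> carrier I" "y \<in> carrier J"
  shows "ast (\<ominus>\<^bsub>I\<^esub> x) y = \<ominus>\<^bsub>K\<^esub> ast x y"
proof -
  have "ast \<zero>\<^bsub>I\<^esub> y = ast \<zero>\<^bsub>I\<^esub> y \<oplus>\<^bsub>K\<^esub> ast \<zero>\<^bsub>I\<^esub> y"
    using ast_add_left[of "\<zero>\<^bsub>I\<^esub>" "\<zero>\<^bsub>I\<^esub>" y] assms by simp
  then have "ast \<zero>\<^bsub>I\<^esub> y = \<zero>\<^bsub>K\<^esub>"
    using assms ast_closed K.add.r_cancel_one' by (metis I.zero_closed)
  then have "ast (\<ominus>\<^bsub>I\<^esub> x) y \<oplus>\<^bsub>K\<^esub> ast x y = \<zero>\<^bsub>K\<^esub>"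
    using ast_add_left[of "\<ominus>\<^bsub>I\<^esub> x" x y] assms by (simp add: I.l_neg)
  then show ?thesis
    using assms ast_closed K.minus_equality by (metis I.a_inv_closed)
qed

lemma ast_minus_right:
  assumes "x \<in> carrier I" "y \<in> carrier J"
  shows "ast x (\<ominus>\<^bsub>J\<^esub> y) = \<ominus>\<^bsub>K\<^esub> ast x y"
proof -
  have "ast x \<zero>\<^bsub>J\<^esub> = ast x \<zero>\<^bsub>J\<^esub> \<oplus>\<^bsub>K\<^esub> ast x \<zero>\<^bsub>J\<^esub>"
    using ast_add_right[of x "\<zero>\<^bsub>J\<^esub>" "\<zero>\<^bsub>J\<^esub>"] assms by simp
  then have "ast x \<zero>\<^bsub>J\<^esub> = \<zero>\<^bsub>K\<^esub>"
    using assms ast_closed K.add.r_cancel_one' by (metis J.zero_closed)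
  then have "ast x (\<ominus>\<^bsub>J\<^esub> y) \<oplus>\<^bsub>K\<^esub> ast x y = \<zero>\<^bsub>K\<^esub>"
    using ast_add_right[of x "\<ominus>\<^bsub>J\<^esub> y" y] assms by (simp add: J.l_neg)
  then show ?thesis
    using assms ast_closed K.minus_equality by (metis J.a_inv_closed)
qed

text \<open>The comparison passes through \<open>ast x y'\<close>: the first increment is the
  product of \<open>x\<close> with \<open>y' - y\<close>, the second that of \<open>x' - x\<close>
  with \<open>y'\<close>. Both are products of nonnegative elements.\<close>

lemma ast_mono:
  assumes "x \<in> carrier I" "x' \<in> carrier I" "y \<in> carrier J" "y' \<in> carrier J"
    and "\<zero>\<^bsub>I\<^esub> \<preceq>\<^bsub>leI\<^esub> x" "x \<preceq>\<^bsub>leI\<^esub> x'" "\<zero>\<^bsub>J\<^esub> \<preceq>\<^bsub>leJ\<^esub> y" "y \<preceq>\<^bsub>leJ\<^esub> y'"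
  shows "ast x y \<preceq>\<^bsub>leK\<^esub> ast x' y'"
proof -
  have "\<zero>\<^bsub>I\<^esub> \<preceq>\<^bsub>leI\<^esub> x' \<ominus>\<^bsub>I\<^esub> x" "\<zero>\<^bsub>J\<^esub> \<preceq>\<^bsub>leJ\<^esub> y' \<ominus>\<^bsub>J\<^esub> y" "\<zero>\<^bsub>J\<^esub> \<preceq>\<^bsub>leJ\<^esub> y'"
    using assms I.le_iff_diff_nonneg J.le_iff_diff_nonneg J.le_trans by blast+
  then have "\<zero>\<^bsub>K\<^esub> \<preceq>\<^bsub>leK\<^esub> ast x (y' \<ominus>\<^bsub>J\<^esub> y)" "\<zero>\<^bsub>K\<^esub> \<preceq>\<^bsub>leK\<^esub> ast (x' \<ominus>\<^bsub>I\<^esub> x) y'"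
    using assms by (auto intro!: ast_nonneg)
  moreover have "ast x (y' \<ominus>\<^bsub>J\<^esub> y) = ast x y' \<ominus>\<^bsub>K\<^esub> ast x y"
    "ast (x' \<ominus>\<^bsub>I\<^esub> x) y' = ast x' y' \<ominus>\<^bsub>K\<^esub> ast x y'"
    using assms
    by (simp_all add: I.minus_eq J.minus_eq K.minus_eq ast_add_right ast_add_left
        ast_minus_right ast_minus_left)
  ultimately show ?thesis
    using assms ast_closed K.le_iff_diff_nonneg K.le_trans by metis
qed

end

lemma po_bilinearI:
  assumes "class_C I leI J leJ K leK ast"
  shows "po_bilinear I leI J leJ K leK ast"
  using assms by (simp add: po_bilinear_def po_bilinear_axioms_def class_C_def po_groupI)

section \<open>The inequality with real coefficients\<close>

text \<open>Here the sum can be expanded exactly: with \<open>A\<close>, \<open>B\<close>,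
  \<open>D\<close> the products of \<open>u\<close> and \<open>s\<close>, \<open>u\<close> and
  \<open>t\<close>, \<open>v\<close> and \<open>t\<close>, it equals
  \<open>a A + (a - b + c) B + c D\<close>, a combination of nonnegative elements with nonnegative
  coefficients.\<close>

lemma scalar_inequality:
  fixes K :: "(real, 'k, 'n) module_scheme" and a b c :: real
  assumes C: "class_C I leI J leJ K leK ast" and car: "carrier I = carrier J" and le: "leI = leJ"
    and V: "po_real_vector_space K leK"
    and xyz: "x \<in> carrier I" "y \<in> carrier I" "z \<in> carrier I" "y \<preceq>\<^bsub>leI\<^esub> x" "z \<preceq>\<^bsub>leI\<^esub> y"
    and abc: "a \<ge> 0" "c \<ge> 0" "a + c \<ge> \<bar>b\<bar>"
  shows "\<zero>\<^bsub>K\<^esub> \<preceq>\<^bsub>leK\<^esub>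
          (a \<odot>\<^bsub>K\<^esub> ast (x \<ominus>\<^bsub>I\<^esub> y) (x \<ominus>\<^bsub>J\<^esub> z)) \<oplus>\<^bsub>K\<^esub>
          (b \<odot>\<^bsub>K\<^esub> ast (y \<ominus>\<^bsub>I\<^esub> x) (y \<ominus>\<^bsub>J\<^esub> z)) \<oplus>\<^bsub>K\<^esub>
          (c \<odot>\<^bsub>K\<^esub> ast (z \<ominus>\<^bsub>I\<^esub> x) (z \<ominus>\<^bsub>J\<^esub> y))"
proof -
  interpret po_bilinear I leI J leJ K leK ast using C by (rule po_bilinearI)
  interpret V: module "ring_of_type_algebra :: real ring" K
    using V by (simp add: po_real_vector_space_def)
  \<comment> \<open>Unfolding the record of the real field turns the module axioms into statements
    about ordinary real arithmetic.\<close>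
  have R: "carrier (ring_of_type_algebra :: real ring) = UNIV"
    "add (ring_of_type_algebra :: real ring) = (+)"
    by (simp_all add: ring_of_type_algebra_def)
  have smult_add: "(r + s) \<odot>\<^bsub>K\<^esub> g = r \<odot>\<^bsub>K\<^esub> g \<oplus>\<^bsub>K\<^esub> s \<odot>\<^bsub>K\<^esub> g" if "g \<in> carrier K" for r s :: real and g
    using V.smult_l_distr[of r s g] that by (simp add: R)
  \<comment> \<open>Moving the sign from the vector to the scalar lets the \<open>b\<close> summand
    merge with the other multiples of \<open>B\<close>.\<close>
  have smult_minus: "r \<odot>\<^bsub>K\<^esub> (\<ominus>\<^bsub>K\<^esub> g) = (- r) \<odot>\<^bsub>K\<^esub> g" if "g \<in> carrier K" for r :: real and g
  proof -
    have "\<zero>\<^bsub>ring_of_type_algebra\<^esub> = (0 :: real)" by (simp add: ring_of_type_algebra_def)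
    then have "(- r) \<odot>\<^bsub>K\<^esub> g \<oplus>\<^bsub>K\<^esub> r \<odot>\<^bsub>K\<^esub> g = \<zero>\<^bsub>K\<^esub>"
      using that smult_add[of g "- r" r] V.smult_l_null[of g] by simp
    then have "\<ominus>\<^bsub>K\<^esub> (r \<odot>\<^bsub>K\<^esub> g) = (- r) \<odot>\<^bsub>K\<^esub> g"
      using that by (intro K.minus_equality) (simp_all add: R)
    then show ?thesis using that by (simp add: V.smult_r_minus R)
  qed
  have smult_nonneg: "\<zero>\<^bsub>K\<^esub> \<preceq>\<^bsub>leK\<^esub> r \<odot>\<^bsub>K\<^esub> g" if "g \<in> carrier K" "\<zero>\<^bsub>K\<^esub> \<preceq>\<^bsub>leK\<^esub> g" "r \<ge> 0" for r :: real and g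
  proof -
    have "r \<odot>\<^bsub>K\<^esub> \<zero>\<^bsub>K\<^esub> \<preceq>\<^bsub>leK\<^esub> r \<odot>\<^bsub>K\<^esub> g"
      using V that K.zero_closed unfolding po_real_vector_space_def by blast
    then show ?thesis by (simp add: R)
  qed
  \<comment> \<open>\<open>I\<close> and \<open>J\<close> may carry different additions on the same ordered set, so each difference
    has to be decomposed in its own group.\<close>
  define u where "u = x \<ominus>\<^bsub>I\<^esub> y"
  define v where "v = y \<ominus>\<^bsub>I\<^esub> z"
  define s where "s = x \<ominus>\<^bsub>J\<^esub> y"
  define t where "t = y \<ominus>\<^bsub>J\<^esub> z"
  have carI: "u \<in> carrier I" "v \<in> carrier I" and carJ: "s \<in> carrier J" "t \<in> carrier J"
    using xyz car by (auto simp: u_def v_def s_def t_def)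
  have nonneg: "\<zero>\<^bsub>I\<^esub> \<preceq>\<^bsub>leI\<^esub> u" "\<zero>\<^bsub>I\<^esub> \<preceq>\<^bsub>leI\<^esub> v" "\<zero>\<^bsub>J\<^esub> \<preceq>\<^bsub>leJ\<^esub> s" "\<zero>\<^bsub>J\<^esub> \<preceq>\<^bsub>leJ\<^esub> t"
    using xyz car le I.le_iff_diff_nonneg J.le_iff_diff_nonneg
    by (auto simp: u_def v_def s_def t_def)
  \<comment> \<open>The long difference is split as \<open>u + v\<close> in \<open>I\<close> for the
    left factor of the third summand, and as \<open>s + t\<close> in \<open>J\<close> for the right
    factor of the first.\<close>
  have diffs: "y \<ominus>\<^bsub>I\<^esub> x = \<ominus>\<^bsub>I\<^esub> u" "x \<ominus>\<^bsub>J\<^esub> z = s \<oplus>\<^bsub>J\<^esub> t" "z \<ominus>\<^bsub>J\<^esub> y = \<ominus>\<^bsub>J\<^esub> t"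
    "z \<ominus>\<^bsub>I\<^esub> x = \<ominus>\<^bsub>I\<^esub> (u \<oplus>\<^bsub>I\<^esub> v)"
    using xyz car I.minus_diff_eq J.minus_diff_eq I.diff_eq_add_diffs[of x y z, symmetric]
      J.diff_eq_add_diffs[of x y z, symmetric]
    by (simp_all add: u_def v_def s_def t_def)
  define A where "A = ast u s"
  define B where "B = ast u t"
  define D where "D = ast v t"
  have carK: "A \<in> carrier K" "B \<in> carrier K" "D \<in> carrier K"
    using carI carJ ast_closed by (auto simp: A_def B_def D_def)
  have K: "\<zero>\<^bsub>K\<^esub> \<preceq>\<^bsub>leK\<^esub> A" "\<zero>\<^bsub>K\<^esub> \<preceq>\<^bsub>leK\<^esub> B" "\<zero>\<^bsub>K\<^esub> \<preceq>\<^bsub>leK\<^esub> D"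
    using carI carJ nonneg ast_nonneg by (auto simp: A_def B_def D_def)
  have prods: "ast u (s \<oplus>\<^bsub>J\<^esub> t) = A \<oplus>\<^bsub>K\<^esub> B" "ast (\<ominus>\<^bsub>I\<^esub> u) t = \<ominus>\<^bsub>K\<^esub> B"
    "ast (\<ominus>\<^bsub>I\<^esub> (u \<oplus>\<^bsub>I\<^esub> v)) (\<ominus>\<^bsub>J\<^esub> t) = B \<oplus>\<^bsub>K\<^esub> D"
    using carI carJ carK
    by (simp_all add: A_def B_def D_def ast_add_left ast_add_right ast_minus_left
        ast_minus_right ast_closed)
  \<comment> \<open>The coefficient is kept as \<open>a + (- b) + c\<close>, with
    \<open>add_uminus_conv_diff\<close> switched off, so that \<open>smult_add\<close> can split
    it.\<close>
  have "a \<odot>\<^bsub>K\<^esub> ast u (s \<oplus>\<^bsub>J\<^esub> t) \<oplus>\<^bsub>K\<^esub> b \<odot>\<^bsub>K\<^esub> ast (\<ominus>\<^bsub>I\<^esub> u) t \<oplus>\<^bsub>K\<^esub>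
      c \<odot>\<^bsub>K\<^esub> ast (\<ominus>\<^bsub>I\<^esub> (u \<oplus>\<^bsub>I\<^esub> v)) (\<ominus>\<^bsub>J\<^esub> t)
    = a \<odot>\<^bsub>K\<^esub> A \<oplus>\<^bsub>K\<^esub> (a + (- b) + c) \<odot>\<^bsub>K\<^esub> B \<oplus>\<^bsub>K\<^esub> c \<odot>\<^bsub>K\<^esub> D"
    unfolding prods using carK
    by (simp add: smult_add smult_minus V.smult_r_distr R K.a_ac
        del: add_uminus_conv_diff)
  moreover have "\<zero>\<^bsub>K\<^esub> \<preceq>\<^bsub>leK\<^esub> a \<odot>\<^bsub>K\<^esub> A \<oplus>\<^bsub>K\<^esub> (a + (- b) + c) \<odot>\<^bsub>K\<^esub> B \<oplus>\<^bsub>K\<^esub> c \<odot>\<^bsub>K\<^esub> D"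
    using carK K abc by (intro K.add_nonneg smult_nonneg) (auto simp: R)
  ultimately show ?thesis unfolding diffs u_def[symmetric] t_def[symmetric] by simp
qed

section \<open>Signs, monotonicity and additivity of bracketed products\<close>

text \<open>Ensures that the leading factor of a bracketed product lies in the left subtree, and
  limits the shapes of small trees.\<close>

lemma num_factors_pos: "0 < num_factors t"
  by (induction t) auto

locale po_product = M: po_bilinear I leI I leI I leI ast
  for I :: "('i, 'l) ring_scheme" (structure) and leI ast
begin

text \<open>Signs are booleans, so that multiplying them is exclusive or, written
  \<open>r \<noteq> s\<close>, and a product of many signs is a parity.\<close>

definition signed :: "bool \<Rightarrow> 'i \<Rightarrow> 'i" where
  "signed s x = (if s then \<ominus> x else x)"

lemma signed_closed: "x \<in> carrier I \<Longrightarrow> signed s x \<in> carrier I"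
  by (simp add: signed_def)

lemma ast_signed:
  assumes "x \<in> carrier I" "y \<in> carrier I"
  shows "ast (signed r x) (signed s y) = signed (r \<noteq> s) (ast x y)"
  using assms by (auto simp: signed_def M.ast_minus_left M.ast_minus_right M.ast_closed)

lemma bprod_closed:
  "length xs = num_factors t \<Longrightarrow> set xs \<subseteq> carrier I \<Longrightarrow> bprod ast t xs \<in> carrier I"
proof (induction t arbitrary: xs)
  case Factor
  then show ?case by (cases xs) auto
next
  case (Bracket s t)
  have "bprod ast s (take (num_factors s) xs) \<in> carrier I"
    using Bracket.prems by (intro Bracket.IH) (auto dest: in_set_takeD)
  moreover have "bprod ast t (drop (num_factors s) xs) \<in> carrier I"
    using Bracket.prems by (intro Bracket.IH) (auto dest: in_set_dropD)
  ultimately show ?case by (simp add: M.ast_closed)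
qed

text \<open>Nonnegativity and comparison are proved in one induction, because
  \<open>ast_mono\<close> at a node needs the smaller subproducts to be nonnegative.\<close>

lemma bprod_mono:
  "length xs = num_factors t \<Longrightarrow> set xs \<subseteq> carrier I \<Longrightarrow> set ys \<subseteq> carrier I \<Longrightarrow>
    list_all2 (\<lambda>x y. \<zero> \<preceq>\<^bsub>leI\<^esub> x \<and> x \<preceq>\<^bsub>leI\<^esub> y) xs ys \<Longrightarrow>
    \<zero> \<preceq>\<^bsub>leI\<^esub> bprod ast t xs \<and> bprod ast t xs \<preceq>\<^bsub>leI\<^esub> bprod ast t ys"
proof (induction t arbitrary: xs ys)
  case Factor
  then show ?case by (cases xs; cases ys) auto
next
  case (Bracket s t)
  let ?k = "num_factors s"
  have len: "length ys = length xs" using list_all2_lengthD[OF Bracket.prems(4)] by simp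
  have sub: "set (take ?k xs) \<subseteq> carrier I" "set (take ?k ys) \<subseteq> carrier I"
    "set (drop ?k xs) \<subseteq> carrier I" "set (drop ?k ys) \<subseteq> carrier I"
    using Bracket.prems(2,3) by (auto dest: in_set_takeD in_set_dropD)
  have s: "\<zero> \<preceq>\<^bsub>leI\<^esub> bprod ast s (take ?k xs) \<and>
      bprod ast s (take ?k xs) \<preceq>\<^bsub>leI\<^esub> bprod ast s (take ?k ys)"
    by (rule Bracket.IH(1)[OF _ sub(1,2) list_all2_takeI[OF Bracket.prems(4)]])
      (use Bracket.prems(1) in simp)
  have t: "\<zero> \<preceq>\<^bsub>leI\<^esub> bprod ast t (drop ?k xs) \<and>
      bprod ast t (drop ?k xs) \<preceq>\<^bsub>leI\<^esub> bprod ast t (drop ?k ys)"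
    by (rule Bracket.IH(2)[OF _ sub(3,4) list_all2_dropI[OF Bracket.prems(4)]])
      (use Bracket.prems(1) in simp)
  have "bprod ast s (take ?k xs) \<in> carrier I" "bprod ast s (take ?k ys) \<in> carrier I"
    "bprod ast t (drop ?k xs) \<in> carrier I" "bprod ast t (drop ?k ys) \<in> carrier I"
    using Bracket.prems(1) len sub by (auto intro!: bprod_closed)
  then show ?case using s t M.ast_nonneg M.ast_mono by simp
qed

text \<open>The head always sits in the left subtree, so the induction descends only there and
  \<open>ast_add_left\<close> suffices at each node.\<close>

lemma bprod_add_head:
  "Suc (length xs) = num_factors t \<Longrightarrow> a \<in> carrier I \<Longrightarrow> b \<in> carrier I \<Longrightarrow> set xs \<subseteq> carrier I \<Longrightarrow>
    bprod ast t ((a \<oplus> b) # xs) = bprod ast t (a # xs) \<oplus> bprod ast t (b # xs)"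
proof (induction t arbitrary: xs)
  case Factor
  then show ?case by simp
next
  case (Bracket s t)
  \<comment> \<open>The successor form lets \<open>take\<close> and \<open>drop\<close> step over
    the head: the left subtree gets the head and \<open>k\<close> further factors.\<close>
  obtain k where k: "num_factors s = Suc k"
    using num_factors_pos[of s] by (cases "num_factors s") auto
  have sub: "set (take k xs) \<subseteq> carrier I" "set (drop k xs) \<subseteq> carrier I"
    using Bracket.prems by (auto dest: in_set_takeD in_set_dropD)
  have len: "Suc (length (take k xs)) = num_factors s" "length (drop k xs) = num_factors t"
    using Bracket.prems k by auto
  have "bprod ast s (a # take k xs) \<in> carrier I" "bprod ast s (b # take k xs) \<in> carrier I"
    "bprod ast t (drop k xs) \<in> carrier I"
    using Bracket.prems len sub by (auto intro!: bprod_closed)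
  moreover have "bprod ast s ((a \<oplus> b) # take k xs) =
      bprod ast s (a # take k xs) \<oplus> bprod ast s (b # take k xs)"
    using Bracket.prems len sub by (intro Bracket.IH) auto
  ultimately show ?case using k by (simp add: M.ast_add_left)
qed

text \<open>Each factor carries its own sign flag. At a node \<open>ast_signed\<close> combines the
  two parities by exclusive or, which is the parity of the combined count.\<close>

lemma bprod_signed:
  "length ps = num_factors t \<Longrightarrow> snd ` set ps \<subseteq> carrier I \<Longrightarrow>
    bprod ast t (map (\<lambda>(s, x). signed s x) ps) =
      signed (odd (length (filter fst ps))) (bprod ast t (map snd ps))"
proof (induction t arbitrary: ps)
  case Factor
  then show ?case by (cases ps) auto
next
  case (Bracket s t)
  define P where "P = take (num_factors s) ps"
  define Q where "Q = drop (num_factors s) ps"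
  have ps: "ps = P @ Q" and len: "length P = num_factors s" "length Q = num_factors t"
    using Bracket.prems by (auto simp: P_def Q_def)
  have sub: "snd ` set P \<subseteq> carrier I" "snd ` set Q \<subseteq> carrier I"
    using Bracket.prems ps by auto
  have "bprod ast s (map snd P) \<in> carrier I" "bprod ast t (map snd Q) \<in> carrier I"
    using len sub by (auto intro!: bprod_closed)
  then show ?case
    using Bracket.IH(1)[OF len(1) sub(1)] Bracket.IH(2)[OF len(2) sub(2)] len
    by (simp add: ps ast_signed)
qed

section \<open>The inequality for an arbitrary bracketing\<close>

text \<open>Common form of the power inequality and the inequality for \<open>p\<close>. Only bounds
  relate \<open>w\<close> to \<open>u\<close> and \<open>v\<close>, so values of a monotone function
  fit as well as differences; \<open>s\<close> records whether reversing a difference changes the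
  sign.\<close>

lemma bprod_inequality:
  assumes a: "a \<in> carrier I" "\<zero> \<preceq>\<^bsub>leI\<^esub> a" and b: "b \<in> carrier I" and c: "c \<in> carrier I" "\<zero> \<preceq>\<^bsub>leI\<^esub> c"
    and ub: "a \<oplus> c \<in> Above leI {b, \<ominus> b}"
    and car: "u \<in> carrier I" "v \<in> carrier I" "w \<in> carrier I"
    and le: "\<zero> \<preceq>\<^bsub>leI\<^esub> u" "u \<preceq>\<^bsub>leI\<^esub> w" "\<zero> \<preceq>\<^bsub>leI\<^esub> v" "v \<preceq>\<^bsub>leI\<^esub> w"
    and t: "num_factors t = 1 + 2 * n"
  shows "\<zero> \<preceq>\<^bsub>leI\<^esub>
    bprod ast t (a # replicate n u @ replicate n w) \<oplus>
    bprod ast t (b # replicate n (signed s u) @ replicate n v) \<oplus>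
    bprod ast t (c # replicate n (signed s w) @ replicate n (signed s v))"
proof -
  let ?r = "replicate n"
  let ?F = "\<lambda>d. bprod ast t (d # ?r u @ ?r v)"
  have F_closed: "?F d \<in> carrier I" if "d \<in> carrier I" for d
    using that car t by (intro bprod_closed) auto
  \<comment> \<open>The \<open>n\<close> signed copies of \<open>u\<close> in the second summand
    contribute a minus sign exactly when \<open>s\<close> holds and \<open>n\<close> is odd.\<close>
  define \<sigma> where "\<sigma> \<longleftrightarrow> s \<and> odd n"
  \<comment> \<open>Two applications of \<open>bprod_signed\<close> pull the sign out of the copies
    of \<open>u\<close> and put it back onto \<open>b\<close>; both flag lists have the same
    parity.\<close>
  have second: "bprod ast t (b # ?r (signed s u) @ ?r v) = ?F (signed \<sigma> b)"
    using bprod_signed[of "(False, b) # ?r (s, u) @ ?r (False, v)" t]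
      bprod_signed[of "(\<sigma>, b) # ?r (False, u) @ ?r (False, v)" t] b car t
    by (auto simp: \<sigma>_def signed_def set_replicate_conv_if filter_replicate split: if_splits)
  \<comment> \<open>There are either no flags or \<open>2 * n\<close> of them, so the parity is
    even.\<close>
  have third: "bprod ast t (c # ?r (signed s w) @ ?r (signed s v)) = bprod ast t (c # ?r w @ ?r v)"
    using bprod_signed[of "(False, c) # ?r (s, w) @ ?r (s, v)" t] c car t
    by (auto simp: signed_def set_replicate_conv_if filter_replicate split: if_splits)
  have refl: "d \<preceq>\<^bsub>leI\<^esub> d" if "d \<in> carrier I" for d using that by (rule M.I.le_refl)
  have rel: "list_all2 (\<lambda>x y. \<zero> \<preceq>\<^bsub>leI\<^esub> x \<and> x \<preceq>\<^bsub>leI\<^esub> y) (?r d) (?r f)"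
    if "\<zero> \<preceq>\<^bsub>leI\<^esub> d" "d \<preceq>\<^bsub>leI\<^esub> f" for d f
    using that by (intro list_all2_all_nthI) auto
  \<comment> \<open>Used three times: raising \<open>v\<close> to \<open>w\<close> for the first
    summand, raising \<open>u\<close> to \<open>w\<close> for the third, and with nothing raised for
    the nonnegativity of the collected product.\<close>
  have mono: "\<zero> \<preceq>\<^bsub>leI\<^esub> ?F d \<and> ?F d \<preceq>\<^bsub>leI\<^esub> bprod ast t (d # ?r p @ ?r q)"
    if "d \<in> carrier I" "\<zero> \<preceq>\<^bsub>leI\<^esub> d" "p \<in> carrier I" "q \<in> carrier I" "u \<preceq>\<^bsub>leI\<^esub> p" "v \<preceq>\<^bsub>leI\<^esub> q" for d p q
  proof (rule bprod_mono)
    show "list_all2 (\<lambda>x y. \<zero> \<preceq>\<^bsub>leI\<^esub> x \<and> x \<preceq>\<^bsub>leI\<^esub> y) (d # ?r u @ ?r v) (d # ?r p @ ?r q)"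
      using rel[OF le(1) that(5)] rel[OF le(3) that(6)] refl[OF that(1)] that(2)
      by (simp add: list_all2_appendI)
  qed (use that car t in \<open>auto simp: set_replicate_conv_if\<close>)
  have first_le: "?F a \<preceq>\<^bsub>leI\<^esub> bprod ast t (a # ?r u @ ?r w)"
    using mono[OF a car(1,3) refl[OF car(1)] le(4)] by (rule conjunct2)
  have third_le: "?F c \<preceq>\<^bsub>leI\<^esub> bprod ast t (c # ?r w @ ?r v)"
    using mono[OF c car(3,2) le(2) refl[OF car(2)]] by (rule conjunct2)
  \<comment> \<open>The three products with common factors \<open>u\<close> and \<open>v\<close> are
    collected under one leading coefficient, whose sign is known from the upper bound
    hypothesis.\<close>
  have "a \<oplus> signed \<sigma> b \<oplus> c \<in> carrier I" "\<zero> \<preceq>\<^bsub>leI\<^esub> a \<oplus> signed \<sigma> b \<oplus> c"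
    using a b c ub M.I.coefficient_nonneg[of a b c \<sigma>] by (simp_all add: signed_def)
  from mono[OF this car(1,2) refl[OF car(1)] refl[OF car(2)]]
  have "\<zero> \<preceq>\<^bsub>leI\<^esub> ?F (a \<oplus> signed \<sigma> b \<oplus> c)" by (rule conjunct1)
  also have "?F (a \<oplus> signed \<sigma> b \<oplus> c) = ?F a \<oplus> ?F (signed \<sigma> b) \<oplus> ?F c"
    using a b c car t
    by (simp add: bprod_add_head signed_closed set_replicate_conv_if)
  finally have "\<zero> \<preceq>\<^bsub>leI\<^esub> ?F a \<oplus> ?F (signed \<sigma> b) \<oplus> ?F c" .
  moreover have "?F a \<oplus> ?F (signed \<sigma> b) \<oplus> ?F c \<preceq>\<^bsub>leI\<^esub>
      bprod ast t (a # ?r u @ ?r w) \<oplus> ?F (signed \<sigma> b) \<oplus> bprod ast t (c # ?r w @ ?r v)"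
    by (intro M.I.add_mono first_le third_le refl M.I.a_closed F_closed signed_closed
        bprod_closed a b c) (use a c car t in auto)
  ultimately show ?thesis unfolding second third by (rule M.I.le_trans)
qed

section \<open>Powers of differences\<close>

text \<open>Needed for exponent zero, where each power contributes a single \<open>e\<close>. Only
  two trees have three leaves, and both products reduce to \<open>a\<close>.\<close>

lemma bprod_identity:
  assumes "is_identity (carrier I) ast e" "num_factors t = 3" "a \<in> carrier I"
  shows "bprod ast t [a, e, e] = a"
proof (cases t)
  case Factor
  then show ?thesis using assms by simp
next
  case (Bracket r s)
  have pos: "0 < num_factors r" "0 < num_factors s" by (rule num_factors_pos)+
  have one: "q = Factor" if "num_factors q = 1" for q
  proof (cases q)
    case (Bracket q1 q2)
    then show ?thesis using that num_factors_pos[of q1] num_factors_pos[of q2] by simp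
  qed
  have two: "q = Bracket Factor Factor" if "num_factors q = 2" for q
  proof (cases q)
    case (Bracket q1 q2)
    then have "num_factors q1 = 1" "num_factors q2 = 1"
      using that num_factors_pos[of q1] num_factors_pos[of q2] by auto
    then show ?thesis using Bracket one by simp
  qed (use that in simp)
  consider "num_factors r = 1" "num_factors s = 2" | "num_factors r = 2" "num_factors s = 1"
    using assms(2) Bracket pos by fastforce
  then show ?thesis
  proof cases
    case 1
    then have "t = Bracket Factor (Bracket Factor Factor)" using Bracket one two by simp
    then show ?thesis using assms by (simp add: is_identity_def)
  next
    case 2
    then have "t = Bracket (Bracket Factor Factor) Factor" using Bracket one two by simp
    then show ?thesis using assms by (simp add: is_identity_def)
  qed
qed

text \<open>The term \<open>max n 1\<close> counts the length of \<open>power_word\<close>, which is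
  1 rather than 0 for exponent zero. For positive \<open>n\<close> this is
  \<open>bprod_inequality\<close> applied to the differences, with sign flag
  \<open>True\<close>.\<close>

lemma power_inequality:
  assumes xyz: "x \<in> carrier I" "y \<in> carrier I" "z \<in> carrier I" "y \<preceq>\<^bsub>leI\<^esub> x" "z \<preceq>\<^bsub>leI\<^esub> y"
    and abc: "a \<in> carrier I" "b \<in> carrier I" "c \<in> carrier I" "\<zero> \<preceq>\<^bsub>leI\<^esub> a" "\<zero> \<preceq>\<^bsub>leI\<^esub> c"
    and ub: "a \<oplus> c \<in> Above leI {b, \<ominus> b}"
    and e: "n = 0 \<longrightarrow> is_identity (carrier I) ast e"
    and t: "num_factors t = 1 + 2 * max n 1"
  shows "\<zero> \<preceq>\<^bsub>leI\<^esub>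
    bprod ast t (a # power_word e (x \<ominus> y) n @ power_word e (x \<ominus> z) n) \<oplus>
    bprod ast t (b # power_word e (y \<ominus> x) n @ power_word e (y \<ominus> z) n) \<oplus>
    bprod ast t (c # power_word e (z \<ominus> x) n @ power_word e (z \<ominus> y) n)"
proof (cases "n = 0")
  \<comment> \<open>All powers equal \<open>e\<close>, reversed differences included, so the sum is
    \<open>a + b + c\<close> and \<open>b\<close> keeps its sign.\<close>
  case True
  then have "bprod ast t [d, e, e] = d" if "d \<in> carrier I" for d
    using e t that by (intro bprod_identity) auto
  then show ?thesis
    using True abc M.I.coefficient_nonneg[of a b c False] ub by (simp add: power_word_def)
next
  case False
  have sgn: "y \<ominus> x = signed True (x \<ominus> y)" "z \<ominus> x = signed True (x \<ominus> z)"
    "z \<ominus> y = signed True (y \<ominus> z)"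
    using xyz by (simp_all add: signed_def M.I.minus_diff_eq)
  have w: "x \<ominus> z = (x \<ominus> y) \<oplus> (y \<ominus> z)" using xyz by (intro M.I.diff_eq_add_diffs)
  have pos: "\<zero> \<preceq>\<^bsub>leI\<^esub> x \<ominus> y" "\<zero> \<preceq>\<^bsub>leI\<^esub> y \<ominus> z" using xyz M.I.le_iff_diff_nonneg by auto
  have le: "x \<ominus> y \<preceq>\<^bsub>leI\<^esub> x \<ominus> z" "y \<ominus> z \<preceq>\<^bsub>leI\<^esub> x \<ominus> z"
    unfolding w using xyz pos by (auto intro!: M.I.le_add_nonneg)
  have "num_factors t = 1 + 2 * n" using t False by (simp add: max_def)
  then have "\<zero> \<preceq>\<^bsub>leI\<^esub>
    bprod ast t (a # replicate n (x \<ominus> y) @ replicate n (x \<ominus> z)) \<oplus>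
    bprod ast t (b # replicate n (signed True (x \<ominus> y)) @ replicate n (y \<ominus> z)) \<oplus>
    bprod ast t (c # replicate n (signed True (x \<ominus> z)) @ replicate n (signed True (y \<ominus> z)))"
    using abc ub xyz pos le by (intro bprod_inequality) auto
  then show ?thesis unfolding sgn power_word_def using False by simp
qed

section \<open>Functions of class G\<close>

text \<open>This is \<open>bprod_inequality\<close> with exponent 1, applied to the values of
  \<open>p\<close> at the three differences. Monotonicity of \<open>p\<close> supplies the bounds,
  and its parity supplies the sign flag.\<close>

lemma class_G_inequality:
  assumes xyz: "x \<in> carrier I" "y \<in> carrier I" "z \<in> carrier I" "y \<preceq>\<^bsub>leI\<^esub> x" "z \<preceq>\<^bsub>leI\<^esub> y"
    and abc: "a \<in> carrier I" "b \<in> carrier I" "c \<in> carrier I" "\<zero> \<preceq>\<^bsub>leI\<^esub> a" "\<zero> \<preceq>\<^bsub>leI\<^esub> c"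
    and ub: "a \<oplus> c \<in> Above leI {b, \<ominus> b}"
    and p: "class_G I leI p"
    and t: "num_factors t = 3"
  shows "\<zero> \<preceq>\<^bsub>leI\<^esub>
    bprod ast t [a, p (x \<ominus> y), p (x \<ominus> z)] \<oplus>
    bprod ast t [b, p (y \<ominus> x), p (y \<ominus> z)] \<oplus>
    bprod ast t [c, p (z \<ominus> x), p (z \<ominus> y)]"
proof -
  note p_conjs = p[unfolded class_G_def]
  have p_closed: "p d \<in> carrier I" if "d \<in> carrier I" for d
    using p_conjs[THEN conjunct1] that by (rule funcset_mem)
  have p_mono: "p d \<preceq>\<^bsub>leI\<^esub> p f" if "d \<in> carrier I" "f \<in> carrier I" "\<zero> \<preceq>\<^bsub>leI\<^esub> d" "d \<preceq>\<^bsub>leI\<^esub> f" for d f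
    using p_conjs[THEN conjunct2, THEN conjunct2, THEN conjunct1] that by blast
  \<comment> \<open>The chain is zero, then \<open>p \<zero>\<close>, then
    \<open>p d\<close>.\<close>
  have p_nonneg: "\<zero> \<preceq>\<^bsub>leI\<^esub> p d" if "d \<in> carrier I" "\<zero> \<preceq>\<^bsub>leI\<^esub> d" for d
    using p_conjs[THEN conjunct2, THEN conjunct1]
      p_mono[OF M.I.zero_closed that(1) M.I.le_refl[OF M.I.zero_closed] that(2)]
    by (rule M.I.le_trans)
  \<comment> \<open>One flag serves all arguments: \<open>False\<close> for even \<open>p\<close>,
    \<open>True\<close> for odd \<open>p\<close>.\<close>
  have "\<exists>s. \<forall>d\<in>carrier I. p (\<ominus> d) = signed s (p d)"
    using p_conjs[THEN conjunct2, THEN conjunct2, THEN conjunct2]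
  proof
    assume even: "\<forall>d\<in>carrier I. p d = p (\<ominus> d)"
    have "p (\<ominus> d) = signed False (p d)" if "d \<in> carrier I" for d
      using even[rule_format, OF that] by (simp add: signed_def)
    then show ?thesis by blast
  next
    assume odd: "\<forall>d\<in>carrier I. p d = \<ominus> p (\<ominus> d)"
    have "p (\<ominus> d) = signed True (p d)" if "d \<in> carrier I" for d
      \<comment> \<open>Oddness is instantiated at \<open>\<ominus> d\<close>, where the double
        negation cancels.\<close>
      using odd[rule_format, OF M.I.a_inv_closed[OF that]] that by (simp add: signed_def)
    then show ?thesis by blast
  qed
  then obtain s where s: "p (\<ominus> d) = signed s (p d)" if "d \<in> carrier I" for d by blast
  have sgn: "p (y \<ominus> x) = signed s (p (x \<ominus> y))" "p (z \<ominus> x) = signed s (p (x \<ominus> z))"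
    "p (z \<ominus> y) = signed s (p (y \<ominus> z))"
    using xyz by (simp_all add: s flip: M.I.minus_diff_eq[of x y] M.I.minus_diff_eq[of x z]
        M.I.minus_diff_eq[of y z])
  have w: "x \<ominus> z = (x \<ominus> y) \<oplus> (y \<ominus> z)" using xyz by (intro M.I.diff_eq_add_diffs)
  have pos: "\<zero> \<preceq>\<^bsub>leI\<^esub> x \<ominus> y" "\<zero> \<preceq>\<^bsub>leI\<^esub> y \<ominus> z" using xyz M.I.le_iff_diff_nonneg by auto
  have le: "x \<ominus> y \<preceq>\<^bsub>leI\<^esub> x \<ominus> z" "y \<ominus> z \<preceq>\<^bsub>leI\<^esub> x \<ominus> z"
    unfolding w using xyz pos by (auto intro!: M.I.le_add_nonneg)
  \<comment> \<open>Single values of \<open>p\<close> are written as \<open>replicate 1\<close> to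
    match the shape of the general inequality.\<close>
  have "\<zero> \<preceq>\<^bsub>leI\<^esub>
    bprod ast t (a # replicate 1 (p (x \<ominus> y)) @ replicate 1 (p (x \<ominus> z))) \<oplus>
    bprod ast t (b # replicate 1 (signed s (p (x \<ominus> y))) @ replicate 1 (p (y \<ominus> z))) \<oplus>
    bprod ast t (c # replicate 1 (signed s (p (x \<ominus> z))) @ replicate 1 (signed s (p (y \<ominus> z))))"
    using abc ub xyz pos le t by (intro bprod_inequality p_closed p_mono p_nonneg) simp_all
  then show ?thesis unfolding sgn by simp
qed

end

section \<open>The three inequalities together\<close>

lemma po_productI:
  assumes "class_C2 I leI ast"
  shows "po_product I leI ast"
  using assms by (simp add: po_product_def class_C2_def po_bilinearI)

theorem theorem10:
  fixes n :: nat
  shows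
    "(\<forall>(I :: ('i, 'l) ring_scheme) leI (J :: ('i, 'm) ring_scheme) leJ
        (K :: (real, 'k, 'n) module_scheme) leK ast x y z (a::real) (b::real) (c::real).
        class_C I leI J leJ K leK ast \<longrightarrow> carrier I = carrier J \<longrightarrow> leI = leJ \<longrightarrow>
        po_real_vector_space K leK \<longrightarrow>
        x \<in> carrier I \<longrightarrow> y \<in> carrier I \<longrightarrow> z \<in> carrier I \<longrightarrow>
        y \<preceq>\<^bsub>leI\<^esub> x \<longrightarrow> z \<preceq>\<^bsub>leI\<^esub> y \<longrightarrow>
        a \<ge> 0 \<longrightarrow> c \<ge> 0 \<longrightarrow> a + c \<ge> \<bar>b\<bar> \<longrightarrow>
        \<zero>\<^bsub>K\<^esub> \<preceq>\<^bsub>leK\<^esub>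
          (a \<odot>\<^bsub>K\<^esub> ast (x \<ominus>\<^bsub>I\<^esub> y) (x \<ominus>\<^bsub>J\<^esub> z)) \<oplus>\<^bsub>K\<^esub>
          (b \<odot>\<^bsub>K\<^esub> ast (y \<ominus>\<^bsub>I\<^esub> x) (y \<ominus>\<^bsub>J\<^esub> z)) \<oplus>\<^bsub>K\<^esub>
          (c \<odot>\<^bsub>K\<^esub> ast (z \<ominus>\<^bsub>I\<^esub> x) (z \<ominus>\<^bsub>J\<^esub> y)))
     \<and>
     (\<forall>(I :: ('p, 'q) ring_scheme) leI ast x y z a b c e t.
        class_C2 I leI ast \<longrightarrow>
        x \<in> carrier I \<longrightarrow> y \<in> carrier I \<longrightarrow> z \<in> carrier I \<longrightarrow>
        y \<preceq>\<^bsub>leI\<^esub> x \<longrightarrow> z \<preceq>\<^bsub>leI\<^esub> y \<longrightarrow>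
        a \<in> carrier I \<longrightarrow> b \<in> carrier I \<longrightarrow> c \<in> carrier I \<longrightarrow>
        \<zero>\<^bsub>I\<^esub> \<preceq>\<^bsub>leI\<^esub> a \<longrightarrow> \<zero>\<^bsub>I\<^esub> \<preceq>\<^bsub>leI\<^esub> c \<longrightarrow> a \<oplus>\<^bsub>I\<^esub> c \<in> Above leI {b, \<ominus>\<^bsub>I\<^esub> b} \<longrightarrow>
        (n = 0 \<longrightarrow> is_identity (carrier I) ast e) \<longrightarrow>
        num_factors t = 1 + 2 * max n 1 \<longrightarrow>
        \<zero>\<^bsub>I\<^esub> \<preceq>\<^bsub>leI\<^esub>
          bprod ast t (a # power_word e (x \<ominus>\<^bsub>I\<^esub> y) n @ power_word e (x \<ominus>\<^bsub>I\<^esub> z) n) \<oplus>\<^bsub>I\<^esub>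
          bprod ast t (b # power_word e (y \<ominus>\<^bsub>I\<^esub> x) n @ power_word e (y \<ominus>\<^bsub>I\<^esub> z) n) \<oplus>\<^bsub>I\<^esub>
          bprod ast t (c # power_word e (z \<ominus>\<^bsub>I\<^esub> x) n @ power_word e (z \<ominus>\<^bsub>I\<^esub> y) n))
     \<and>
     (\<forall>(I :: (real, 's, 't) module_scheme) leI ast x y z a b c p t.
        class_C2 I leI ast \<longrightarrow> po_real_vector_space I leI \<longrightarrow>
        x \<in> carrier I \<longrightarrow> y \<in> carrier I \<longrightarrow> z \<in> carrier I \<longrightarrow>
        y \<preceq>\<^bsub>leI\<^esub> x \<longrightarrow> z \<preceq>\<^bsub>leI\<^esub> y \<longrightarrow>
        a \<in> carrier I \<longrightarrow> b \<in> carrier I \<longrightarrow> c \<in> carrier I \<longrightarrow>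
        \<zero>\<^bsub>I\<^esub> \<preceq>\<^bsub>leI\<^esub> a \<longrightarrow> \<zero>\<^bsub>I\<^esub> \<preceq>\<^bsub>leI\<^esub> c \<longrightarrow> a \<oplus>\<^bsub>I\<^esub> c \<in> Above leI {b, \<ominus>\<^bsub>I\<^esub> b} \<longrightarrow>
        class_G I leI p \<longrightarrow>
        num_factors t = 3 \<longrightarrow>
        \<zero>\<^bsub>I\<^esub> \<preceq>\<^bsub>leI\<^esub>
          bprod ast t [a, p (x \<ominus>\<^bsub>I\<^esub> y), p (x \<ominus>\<^bsub>I\<^esub> z)] \<oplus>\<^bsub>I\<^esub>
          bprod ast t [b, p (y \<ominus>\<^bsub>I\<^esub> x), p (y \<ominus>\<^bsub>I\<^esub> z)] \<oplus>\<^bsub>I\<^esub>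
          bprod ast t [c, p (z \<ominus>\<^bsub>I\<^esub> x), p (z \<ominus>\<^bsub>I\<^esub> y)])"
proof (intro conjI allI impI, goal_cases)
  case 1
  then show ?case by (rule scalar_inequality)
next
  case 2
  show ?case
    by (rule po_product.power_inequality[OF po_productI[OF 2(1)] 2(2-)])
next
  case 3
  show ?case
    by (rule po_product.class_G_inequality[OF po_productI[OF 3(1)] 3(3-)])
qed

end
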